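(* Consider a $K$-armed stochastic bandit problem with side observations, with side observation graph $G=(V,E)$, $V=\{1,\dots,K\}$, and reward distributions supported in $[0,1]$. For every $n\ge1$, the expected regret of the policy UCB-N after $n$ steps satisfies $$\mathbb E[R(n)]\;\le\;\inf_{\mathcal C}\left\{8\left(\sum_{C\in\mathcal C}\frac{\max_{i\in C}\Delta_i}{\Delta_C^2}\right)\ln n\right\}+\left(1+\frac{\pi^2}{3}\right)\sum_{i=1}^K\Delta_i,$$ where the infimum is over all clique coverings $\mathcal C$ of $G$, and $\Delta_C:=\min_{i\in C}\Delta_i$.
   Context: Setting (stochastic bandit with side observations). There are $K$ arms $V=\{1,\dots,K\}$; arm $i$ has a reward distribution $\mathcal P_i$ supported in $[0,1]$ with mean $\mu_i$. The rewards $X_{i,t}\sim\mathcal P_i$ ($i\in V$, $t\ge1$) are all independent. The side observation graph $G=(V,E)$ is an undirected graph on $V$, and $N(i)$ denotes the set consisting of $i$ and its neighbors in $G$. At each time $t\ge1$ the decision maker pulls an arm $I_t$ based on past observations, receives the reward $X_{I_t,t}$, and observes all the values $X_{j,t}$ for $j\in N(I_t)$. Regret. Let $i^*\in\arg\max_i\mu_i$, $\mu^*=\mu_{i^*}$, $\Delta_i=\mu^*-\mu_i$, and $T_i(n)=\sum_{t=1}^n \mathbf 1\{I_t=i\}$. The regret is $R(n)=\sum_{t=1}^n X_{i^*,t}-\sum_{t=1}^n X_{I_t,t}$, and $\mathbb E[R(n)]=\sum_{i=1}^K\Delta_i\,\mathbb E[T_i(n)]$. Clique coverings. A clique in $G$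 is a subset $C\subset V$ of pairwise adjacent vertices (singletons are cliques). A clique covering of $G$ is a set $\mathcal C$ of cliques with $\bigcup_{C\in\mathcal C}C=V$. Convention for the ratios $\max_{i\in C}\Delta_i/\Delta_C^2$ when $\Delta_C=0$: $0/0=0$ and $x/0=+\infty$ for $x>0$. Policy UCB-N. For each arm $i$ keep a counter $O_i$ (the number of observations of arm $i$ so far) and the empirical mean $\overline X_i$ of these observations, both initialized to $0$. At each step $t=1,2,\dots$: choose $i\in\arg\max_{i\in V}\left\{\overline X_i+\sqrt{\frac{2\ln t}{O_i}}\right\}$, where the index of an arm with $O_i=0$ is $+\infty$ (ties broken arbitrarily); pull arm $I_t=i$; then for every $k\in N(i)$ set $O_k\leftarrow O_k+1$ and $\overline X_k\leftarrow X_{k,t}/O_k+(1-1/O_k)\overline X_k$. *)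

theory Defs
  imports "HOL-Probability.Probability" "HOL-Library.Ramsey"
begin

section \<open>Graphs and clique coverings\<close>

text \<open>A simple undirected graph is given by a vertex set \<open>V\<close> and an edge set \<open>E \<subseteq> [V]\<^bsup>2\<^esup>\<close>.\<close>

definition nbhd :: "'v set set \<Rightarrow> 'v \<Rightarrow> 'v set" where
  "nbhd E i = insert i {j. {i, j} \<in> E}"

text \<open>Cliques are those of \<^theory>\<open>HOL-Library.Ramsey\<close>.  The members of a covering are
  required to be nonempty, because the minimal gap is meaningless for the empty set.\<close>

definition clique_coverings :: "'v set \<Rightarrow> 'v set set \<Rightarrow> 'v set set set" where
  "clique_coverings V E = {\<C>. (\<forall>C\<in>\<C>. C \<subseteq> V \<and> C \<noteq> {} \<and> clique C E) \<and> \<Union>\<C> = V}"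


section \<open>Gaps and regret\<close>

definition arm_mean :: "('v \<Rightarrow> real measure) \<Rightarrow> 'v \<Rightarrow> real" where
  "arm_mean P i = (\<integral>x. x \<partial>P i)"

definition gap :: "('v \<Rightarrow> real measure) \<Rightarrow> 'v \<Rightarrow> 'v \<Rightarrow> real" where
  "gap P istar i = arm_mean P istar - arm_mean P i"

definition clique_gap :: "('v \<Rightarrow> real) \<Rightarrow> 'v set \<Rightarrow> real" where
  "clique_gap \<Delta> C = Min (\<Delta> ` C)"

text \<open>In \<^typ>\<open>ereal\<close>, division satisfies \<open>0 / 0 = 0\<close> and \<open>x / 0 = \<infinity>\<close> for \<open>x > 0\<close>, which is the
  intended convention for cliques with minimal gap zero.\<close>

definition clique_ratio :: "('v \<Rightarrow> real) \<Rightarrow> 'v set \<Rightarrow> ereal" where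
  "clique_ratio \<Delta> C = ereal (Max (\<Delta> ` C)) / ereal ((clique_gap \<Delta> C)\<^sup>2)"

lemma clique_ratio_gap_zero:
  assumes "clique_gap \<Delta> C = 0"
  shows "Max (\<Delta> ` C) = 0 \<Longrightarrow> clique_ratio \<Delta> C = 0"
    and "Max (\<Delta> ` C) > 0 \<Longrightarrow> clique_ratio \<Delta> C = \<infinity>"
  using assms by (simp_all add: clique_ratio_def divide_ereal_def)

text \<open>\<open>X i t \<omega>\<close> is the reward of arm \<open>i\<close> at time \<open>t\<close>, and \<open>I t \<omega>\<close> is the arm pulled at time \<open>t\<close>;
  time starts at 1.\<close>

definition regret ::
  "('v \<Rightarrow> nat \<Rightarrow> 'a \<Rightarrow> real) \<Rightarrow> (nat \<Rightarrow> 'a \<Rightarrow> 'v) \<Rightarrow> 'v \<Rightarrow> nat \<Rightarrow> 'a \<Rightarrow> real" where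
  "regret X I istar n \<omega> = (\<Sum>t=1..n. X istar t \<omega>) - (\<Sum>t=1..n. X (I t \<omega>) t \<omega>)"


section \<open>Bandits with side observations\<close>

locale side_obs_bandit = prob_space M
  for M :: "'a measure" +
  fixes K :: nat
    and E :: "nat set set"
    and P :: "nat \<Rightarrow> real measure"
    and X :: "nat \<Rightarrow> nat \<Rightarrow> 'a \<Rightarrow> real"
  assumes edges: "E \<subseteq> [{1..K}]\<^bsup>2\<^esup>"
    and prob_space_P: "\<And>i. i \<in> {1..K} \<Longrightarrow> prob_space (P i)"
    and sets_P: "\<And>i. i \<in> {1..K} \<Longrightarrow> sets (P i) = sets borel"
    and support_P: "\<And>i. i \<in> {1..K} \<Longrightarrow> AE x in P i. x \<in> {0..1}"
    and distr_X: "\<And>i t. i \<in> {1..K} \<Longrightarrow> t \<ge> 1 \<Longrightarrow> distr M borel (X i t) = P i"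
    and indep_X: "indep_vars (\<lambda>_. borel) (\<lambda>(i, t). X i t) ({1..K} \<times> {1..})"

text \<open>\<open>history K E X U I t\<close> is what the decision maker knows before the decision at time \<open>t\<close>: an
  auxiliary random element \<open>U\<close> and, for each earlier time \<open>s\<close>, the pulled arm together with the
  observed rewards.  Rewards that were not observed at time \<open>s\<close> are masked by 0; this does not
  reveal anything, since the pulled arm determines which arms are observed.\<close>

definition history ::
  "nat \<Rightarrow> nat set set \<Rightarrow> (nat \<Rightarrow> nat \<Rightarrow> 'a \<Rightarrow> real) \<Rightarrow> ('a \<Rightarrow> 'u) \<Rightarrow> (nat \<Rightarrow> 'a \<Rightarrow> nat) \<Rightarrow> nat \<Rightarrow>
    'a \<Rightarrow> 'u \<times> (nat \<Rightarrow> nat \<times> (nat \<Rightarrow> real))" where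
  "history K E X U I t \<omega> =
    (U \<omega>, \<lambda>s\<in>{1..<t}. (I s \<omega>, \<lambda>j\<in>{1..K}. if j \<in> nbhd E (I s \<omega>) then X j s \<omega> else 0))"

definition history_space ::
  "nat \<Rightarrow> 'u measure \<Rightarrow> nat \<Rightarrow> ('u \<times> (nat \<Rightarrow> nat \<times> (nat \<Rightarrow> real))) measure" where
  "history_space K S t =
    S \<Otimes>\<^sub>M (\<Pi>\<^sub>M s\<in>{1..<t}. count_space {1..K} \<Otimes>\<^sub>M (\<Pi>\<^sub>M j\<in>{1..K}. borel))"

text \<open>A policy selects an arm from the history.  The auxiliary element \<open>U\<close> is independent of all
  rewards; it admits randomized decisions (in particular randomized tie-breaking), and a
  deterministic policy is the case where \<open>U\<close> is constant.\<close>

locale side_obs_policy = side_obs_bandit M K E P X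
  for M :: "'a measure" and K E P X +
  fixes S :: "'u measure"
    and U :: "'a \<Rightarrow> 'u"
    and I :: "nat \<Rightarrow> 'a \<Rightarrow> nat"
  assumes measurable_U: "U \<in> measurable M S"
    and indep_U: "indep_set
      (sets (vimage_algebra (space M) U S))
      (sets (vimage_algebra (space M) (\<lambda>\<omega>. \<lambda>(i, t)\<in>{1..K} \<times> {1..}. X i t \<omega>)
        (\<Pi>\<^sub>M _\<in>{1..K} \<times> {1..}. borel)))"
    and decision: "\<And>t. t \<ge> 1 \<Longrightarrow>
      \<exists>\<phi> \<in> measurable (history_space K S t) (count_space {1..K}).
        \<forall>\<omega>\<in>space M. I t \<omega> = \<phi> (history K E X U I t \<omega>)"


section \<open>The policy UCB-N\<close>

text \<open>\<open>obs_count E I k t \<omega>\<close> and \<open>emp_mean E X I k t \<omega>\<close> are the values of the counter and of the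
  empirical mean of arm \<open>k\<close> after the update at time \<open>t\<close>.\<close>

primrec obs_count :: "'v set set \<Rightarrow> (nat \<Rightarrow> 'a \<Rightarrow> 'v) \<Rightarrow> 'v \<Rightarrow> nat \<Rightarrow> 'a \<Rightarrow> nat" where
  "obs_count E I k 0 \<omega> = 0"
| "obs_count E I k (Suc t) \<omega> =
    (if k \<in> nbhd E (I (Suc t) \<omega>) then obs_count E I k t \<omega> + 1 else obs_count E I k t \<omega>)"

primrec emp_mean ::
  "'v set set \<Rightarrow> ('v \<Rightarrow> nat \<Rightarrow> 'a \<Rightarrow> real) \<Rightarrow> (nat \<Rightarrow> 'a \<Rightarrow> 'v) \<Rightarrow> 'v \<Rightarrow> nat \<Rightarrow> 'a \<Rightarrow> real" where
  "emp_mean E X I k 0 \<omega> = 0"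
| "emp_mean E X I k (Suc t) \<omega> =
    (if k \<in> nbhd E (I (Suc t) \<omega>)
     then X k (Suc t) \<omega> / real (obs_count E I k (Suc t) \<omega>)
       + (1 - 1 / real (obs_count E I k (Suc t) \<omega>)) * emp_mean E X I k t \<omega>
     else emp_mean E X I k t \<omega>)"

text \<open>The decision at time \<open>t\<close> uses the counters and means available after time \<open>t - 1\<close>.\<close>

definition ucb_index ::
  "'v set set \<Rightarrow> ('v \<Rightarrow> nat \<Rightarrow> 'a \<Rightarrow> real) \<Rightarrow> (nat \<Rightarrow> 'a \<Rightarrow> 'v) \<Rightarrow> nat \<Rightarrow> 'a \<Rightarrow> 'v \<Rightarrow> ereal" where
  "ucb_index E X I t \<omega> i =
    (if obs_count E I i (t - 1) \<omega> = 0 then \<infinity>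
     else ereal (emp_mean E X I i (t - 1) \<omega>
       + sqrt (2 * ln (real t) / real (obs_count E I i (t - 1) \<omega>))))"

locale ucb_n = side_obs_policy M K E P X S U I
  for M :: "'a measure" and K E P X and S :: "'u measure" and U I +
  assumes ucb_argmax: "\<And>t \<omega>. t \<ge> 1 \<Longrightarrow> \<omega> \<in> space M \<Longrightarrow>
    is_arg_max (ucb_index E X I t \<omega>) (\<lambda>i. i \<in> {1..K}) (I t \<omega>)"

end

theory Submission
  imports Defs
begin

text \<open>
  Let \<open>O\<close> be the number of observations of an arm up to time \<open>t\<close> and \<open>D\<close> the deviation of its
  empirical mean.  For every real \<open>l\<close> the process \<open>exp (O * (l * D - l\<^sup>2 / 8))\<close> is a
  supermartingale by Hoeffding's lemma, so Markov's inequality at \<open>l = \<plusminus> 4 * c\<close> bounds the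
  probability of \<open>O = s\<close> and \<open>\<plusminus> D \<ge> c\<close> by \<open>exp (- 2 * s * c\<^sup>2)\<close>; with \<open>c\<close> the confidence radius
  this is \<open>1 / t ^ 4\<close>.  A pull of a suboptimal arm observed at least \<open>8 * ln n / \<Delta>\<^sup>2\<close> times forces
  such a deviation for this arm or for the optimal one, and summing over the possible values of \<open>s\<close>
  gives probability at most \<open>2 / t\<^sup>2\<close>.  Every pull inside a clique \<open>C\<close> observes the whole clique,
  so at most \<open>8 * ln n / \<Delta>\<^sub>C\<^sup>2 + 1\<close> pulls inside \<open>C\<close> can choose an arm with fewer observations.
\<close>

section \<open>The information available to the decision maker\<close>

lemma Int_stable_preimages: "Int_stable {f -` A \<inter> \<Omega> | A. A \<in> sets N}"
proof (rule Int_stableI)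
  fix a b assume "a \<in> {f -` A \<inter> \<Omega> | A. A \<in> sets N}" "b \<in> {f -` A \<inter> \<Omega> | A. A \<in> sets N}"
  then obtain A B where "A \<in> sets N" "B \<in> sets N" "a = f -` A \<inter> \<Omega>" "b = f -` B \<inter> \<Omega>" by blast
  then show "a \<inter> b \<in> {f -` A \<inter> \<Omega> | A. A \<in> sets N}"
    by (intro CollectI exI[of _ "A \<inter> B"]) auto
qed

lemma (in side_obs_bandit) X_measurable:
  "i \<in> {1..K} \<Longrightarrow> t \<ge> 1 \<Longrightarrow> X i t \<in> borel_measurable M"
  using indep_X unfolding indep_vars_def2 by force

section \<open>Independence of a reward from everything that precedes it\<close>

context side_obs_policy
begin

text \<open>\<open>None\<close> stands for the auxiliary element and \<open>Some (i, t)\<close> for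
  a single reward, so that their mutual independence becomes one statement about a single indexed
  family. Taking preimages only keeps each member intersection-stable.\<close>

definition generator :: "(nat \<times> nat) option \<Rightarrow> 'a set set" where
  "generator b = (case b of
      None \<Rightarrow> {U -` A \<inter> space M | A. A \<in> sets S}
    | Some (i, t) \<Rightarrow> {X i t -` A \<inter> space M | A. A \<in> sets borel})"

text \<open>All rewards before time \<open>t\<close> are included, observed or not. This is more
  than the decision maker knows, but it is still independent of the rewards at time
  \<open>t\<close>. Only the sigma-algebra of this measure matters.\<close>

definition past :: "nat \<Rightarrow> 'a measure" where
  "past t = sigma (space M) (\<Union>b\<in>insert None (Some ` ({1..K} \<times> {1..<t})). generator b)"

lemma Int_stable_generator: "Int_stable (generator b)"
  by (cases b) (auto simp: generator_def Int_stable_preimages)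

lemma generator_subset_events:
  "b \<in> insert None (Some ` ({1..K} \<times> {1..})) \<Longrightarrow> generator b \<subseteq> events"
  using measurable_U X_measurable by (auto simp: generator_def intro: measurable_sets)

text \<open>The rewards are independent among themselves, and a finite intersection of reward events
  lies in the sigma-algebra generated by the whole reward family, from which \<open>U\<close> is
  independent. So the product rule for rewards extends by the factor at \<open>None\<close>.\<close>

lemma indep_sets_generator: "indep_sets generator (insert None (Some ` ({1..K} \<times> {1..})))"
proof (rule indep_setsI)
  fix A J
  assume J: "J \<noteq> {}" "J \<subseteq> insert None (Some ` ({1..K} \<times> {1..}))" "finite J"
    and A: "\<forall>j\<in>J. A j \<in> generator j"
  let ?V = "vimage_algebra (space M) (\<lambda>\<omega>. \<lambda>(i, t)\<in>{1..K} \<times> {1..}. X i t \<omega>)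
        (\<Pi>\<^sub>M _\<in>{1..K} \<times> {1..}. borel)"
  define J' where "J' = {p. Some p \<in> J}"
  have J': "J' \<subseteq> {1..K} \<times> {1..}" "finite J'"
    using J finite_vimageI[of J Some] by (auto simp: J'_def vimage_def)
  have AX: "A (Some p) \<in> (\<lambda>(i, t). {X i t -` A \<inter> space M | A. A \<in> sets borel}) p" if "p \<in> J'" for p
    using A that by (force simp: J'_def generator_def split: prod.splits)
  have ind: "indep_sets (\<lambda>p. (\<lambda>(i, t). {X i t -` A \<inter> space M | A. A \<in> sets borel}) p) ({1..K} \<times> {1..})"
    using indep_X unfolding indep_vars_def2 by (auto simp: case_prod_beta')
  have prodX: "prob (\<Inter>p\<in>J'. A (Some p)) = (\<Prod>p\<in>J'. prob (A (Some p)))" if "J' \<noteq> {}"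
    by (rule indep_setsD[OF ind]) (use J' that AX in auto)
  have vec: "(\<lambda>\<omega>. \<lambda>(i, t)\<in>{1..K} \<times> {1..}. X i t \<omega>) \<in> ?V \<rightarrow>\<^sub>M (\<Pi>\<^sub>M _\<in>{1..K} \<times> {1..}. borel)"
    by (rule measurable_vimage_algebra1) (auto simp: space_PiM)
  have XV: "X i t \<in> ?V \<rightarrow>\<^sub>M borel" if "(i, t) \<in> {1..K} \<times> {1..}" for i t
    using measurable_compose[OF vec measurable_component_singleton[OF that]] that by simp
  have AV: "A (Some p) \<in> sets ?V" if "p \<in> J'" for p
  proof -
    obtain i t where p: "p = (i, t)" by force
    from AX[OF that] obtain B where B: "B \<in> sets borel" "A (Some p) = X i t -` B \<inter> space M"
      by (auto simp: p)
    have "X i t -` B \<inter> space ?V \<in> sets ?V"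
      by (rule measurable_sets[OF XV B(1)]) (use J' that p in auto)
    with B show ?thesis by simp
  qed
  \<comment> \<open>The event of \<open>U\<close>, if present, is separated from the reward
    events.\<close>
  have J_eq: "J = (if None \<in> J then insert None (Some ` J') else Some ` J')"
  proof (rule set_eqI)
    fix q show "q \<in> J \<longleftrightarrow> q \<in> (if None \<in> J then insert None (Some ` J') else Some ` J')"
      by (cases q) (auto simp: J'_def)
  qed
  show "prob (\<Inter>j\<in>J. A j) = (\<Prod>j\<in>J. prob (A j))"
  proof (cases "None \<in> J")
    case False
    then have "J = Some ` J'" using J_eq by auto
    with prodX J(1) show ?thesis by (simp add: prod.reindex)
  next
    case True
    then have eq: "J = insert None (Some ` J')" using J_eq by auto
    show ?thesis
    proof (cases "J' = {}")
      case True
      with eq show ?thesis by simp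
    next
      case False
      have "(\<Inter>p\<in>J'. A (Some p)) \<in> sets ?V"
        using J' False AV by (intro sets.finite_INT) auto
      moreover have "A None \<in> sets (vimage_algebra (space M) U S)"
        using bspec[OF A True] by (auto simp: generator_def intro: in_vimage_algebra)
      ultimately have "prob (A None \<inter> (\<Inter>p\<in>J'. A (Some p)))
          = prob (A None) * prob (\<Inter>p\<in>J'. A (Some p))"
        using indep_setD[OF indep_U] by auto
      with eq J' prodX[OF False] show ?thesis
        by (simp add: prod.reindex)
    qed
  qed
qed (rule generator_subset_events)

lemma space_past [simp]: "space (past t) = space M"
  unfolding past_def by (rule space_measure_of_conv)

lemma generator_subset_Pow: "generator b \<subseteq> Pow (space M)"
  by (auto simp: generator_def split: option.splits)

lemma sets_past:
  "sets (past t) = sigma_sets (space M)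
     (\<Union>b\<in>insert None (Some ` ({1..K} \<times> {1..<t})). generator b)"
  unfolding past_def using generator_subset_Pow by (intro sets_measure_of) blast

text \<open>Independent intersection-stable families can be grouped along disjoint index sets: here
  the single index \<open>Some (i, t)\<close> against the indices that generate
  \<open>past t\<close>.\<close>

lemma indep_set_past:
  assumes "i \<in> {1..K}" "t \<ge> 1"
  shows "indep_set (sigma_sets (space M) {X i t -` A \<inter> space M | A. A \<in> sets borel})
    (sets (past t))"
proof -
  define Q where "Q = case_bool {Some (i, t)} (insert None (Some ` ({1..K} \<times> {1..<t})))"
  have "indep_sets (\<lambda>b. sigma_sets (space M) (\<Union>q\<in>Q b. generator q)) UNIV"
  proof (rule indep_sets_collect_sigma)
    show "indep_sets generator (\<Union> (range Q))"
      by (rule indep_sets_mono_index[OF _ indep_sets_generator])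
        (use assms in \<open>auto simp: Q_def UNIV_bool\<close>)
    show "disjoint_family_on Q UNIV"
      by (auto simp: disjoint_family_on_def Q_def split: bool.splits)
  qed (rule Int_stable_generator)
  then show ?thesis
    unfolding indep_set_def
    by (rule indep_sets_mono_sets) (auto simp: Q_def sets_past generator_def split: bool.split)
qed

lemma sets_past_subset: "sets (past t) \<subseteq> events"
  unfolding sets_past
  by (intro sets.sigma_sets_subset UN_least generator_subset_events) auto

lemma past_measurable_imp: "f \<in> past t \<rightarrow>\<^sub>M N \<Longrightarrow> f \<in> M \<rightarrow>\<^sub>M N"
  using sets_past_subset by (auto simp: measurable_def)

lemma indep_var_past:
  assumes "i \<in> {1..K}" "t \<ge> 1" "Y \<in> borel_measurable (past t)"
  shows "indep_var borel (X i t) borel Y"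
  unfolding indep_var_eq
proof (intro conjI)
  show "indep_set (sigma_sets (space M) {X i t -` A \<inter> space M |A. A \<in> sets borel})
     (sigma_sets (space M) {Y -` A \<inter> space M |A. A \<in> sets borel})"
    using indep_set_past[OF assms(1,2)] unfolding indep_set_def
  proof (rule indep_sets_mono_sets)
    have "sigma_sets (space M) {Y -` A \<inter> space M |A. A \<in> sets borel} \<subseteq> sets (past t)"
      using assms(3) by (intro sets.sigma_sets_subset[of _ "past t", simplified])
        (auto dest: measurable_sets)
    then show "case_bool (sigma_sets (space M) {X i t -` A \<inter> space M |A. A \<in> sets borel})
       (sigma_sets (space M) {Y -` A \<inter> space M |A. A \<in> sets borel}) b
      \<subseteq> case_bool (sigma_sets (space M) {X i t -` A \<inter> space M |A. A \<in> sets borel})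
       (sets (past t)) b" for b
      by (auto split: bool.split)
  qed
qed (use assms X_measurable past_measurable_imp in auto)

section \<open>Measurability of the decisions with respect to the past\<close>

lemma U_measurable_past: "U \<in> past t \<rightarrow>\<^sub>M S"
proof (rule measurableI)
  fix A assume "A \<in> sets S"
  then have "U -` A \<inter> space M \<in> generator None" by (auto simp: generator_def)
  then show "U -` A \<inter> space (past t) \<in> sets (past t)"
    unfolding sets_past space_past by (intro sigma_sets.Basic) blast
qed (use measurable_space[OF measurable_U] in auto)

lemma X_measurable_past:
  assumes "i \<in> {1..K}" "1 \<le> s" "s < t"
  shows "X i s \<in> borel_measurable (past t)"
proof (rule measurableI)
  fix A :: "real set" assume "A \<in> sets borel"
  then have "X i s -` A \<inter> space M \<in> generator (Some (i, s))" by (auto simp: generator_def)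
  then show "X i s -` A \<inter> space (past t) \<in> sets (past t)"
    using assms unfolding sets_past space_past by (intro sigma_sets.Basic) auto
qed auto

text \<open>Strong induction: the history at time \<open>t\<close> is assembled from
  \<open>U\<close>, earlier decisions and earlier rewards. Keeping \<open>t'\<close> fixed
  throughout puts all of them on the same space \<open>past t'\<close>.\<close>

lemma I_measurable_past: "1 \<le> t \<Longrightarrow> t \<le> t' \<Longrightarrow> I t \<in> past t' \<rightarrow>\<^sub>M count_space {1..K}"
proof (induction t rule: less_induct)
  case (less t)
  obtain \<phi> where \<phi>: "\<phi> \<in> history_space K S t \<rightarrow>\<^sub>M count_space {1..K}"
      "\<And>\<omega>. \<omega> \<in> space M \<Longrightarrow> I t \<omega> = \<phi> (history K E X U I t \<omega>)"
    using decision[OF less.prems(1)] by blast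
  have I_s [measurable]: "I s \<in> past t' \<rightarrow>\<^sub>M count_space {1..K}" if "s \<in> {1..<t}" for s
    using less.IH[of s] that less.prems by auto
  have [measurable]: "X j s \<in> borel_measurable (past t')" if "s \<in> {1..<t}" "j \<in> {1..K}" for s j
    using X_measurable_past that less.prems by auto
  have [measurable]: "Measurable.pred (past t') (\<lambda>\<omega>. j \<in> nbhd E (I s \<omega>))" if "s \<in> {1..<t}" for s j
    using that by (intro measurable_compose[OF I_s]) auto
  note U_measurable_past[measurable]
  have "history K E X U I t \<in> past t' \<rightarrow>\<^sub>M history_space K S t"
    unfolding history_def history_space_def by measurable
  then have "(\<lambda>\<omega>. \<phi> (history K E X U I t \<omega>)) \<in> past t' \<rightarrow>\<^sub>M count_space {1..K}"
    using \<phi>(1) by (rule measurable_compose)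
  then show ?case
    by (rule measurable_cong[THEN iffD1, rotated]) (simp add: \<phi>(2))
qed

end


section \<open>Concentration of the empirical means\<close>

text \<open>Both tails of the empirical mean are needed, hence both signs of \<open>l\<close>. A
  negative \<open>l\<close> is the positive case for \<open>- f\<close> on
  \<open>{- b..- a}\<close>.\<close>

lemma (in prob_space) Hoeffdings_lemma_signed:
  fixes f :: "'a \<Rightarrow> real"
  assumes [measurable]: "f \<in> borel_measurable M"
    and ae: "AE x in M. f x \<in> {a..b}" and E0: "expectation f = 0"
  shows "integrable M (\<lambda>x. exp (l * f x))"
    and "expectation (\<lambda>x. exp (l * f x)) \<le> exp (l\<^sup>2 * (b - a)\<^sup>2 / 8)"
proof -
  show int: "integrable M (\<lambda>x. exp (l * f x))"
  proof (rule integrable_const_bound)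
    show "AE x in M. norm (exp (l * f x)) \<le> exp (\<bar>l\<bar> * max \<bar>a\<bar> \<bar>b\<bar>)"
      using ae
    proof eventually_elim
      case (elim x)
      have "l * f x \<le> \<bar>l\<bar> * \<bar>f x\<bar>" by (simp flip: abs_mult)
      also have "\<dots> \<le> \<bar>l\<bar> * max \<bar>a\<bar> \<bar>b\<bar>" using elim by (intro mult_left_mono) auto
      finally show ?case by simp
    qed
  qed simp
  have "(\<integral>\<^sup>+x. exp (l * f x) \<partial>M) \<le> ennreal (exp (l\<^sup>2 * (b - a)\<^sup>2 / 8))"
  proof (cases l "0 :: real" rule: linorder_cases)
    case equal
    then show ?thesis by (simp add: emeasure_space_1)
  next
    case greater
    interpret interval_bounded_random_variable M f a b
      by unfold_locales (use ae in auto)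
    show ?thesis using Hoeffdings_lemma_nn_integral_0[OF greater E0] .
  next
    case less
    interpret interval_bounded_random_variable M "\<lambda>x. - f x" "- b" "- a"
      by unfold_locales (use ae in auto)
    have "(\<integral>\<^sup>+x. exp (- l * - f x) \<partial>M) \<le> ennreal (exp ((- l)\<^sup>2 * (- a - - b)\<^sup>2 / 8))"
      by (rule Hoeffdings_lemma_nn_integral_0) (use less E0 in auto)
    then show ?thesis by (simp add: power2_commute)
  qed
  then have "ennreal (expectation (\<lambda>x. exp (l * f x))) \<le> ennreal (exp (l\<^sup>2 * (b - a)\<^sup>2 / 8))"
    using int by (subst nn_integral_eq_integral[symmetric]) auto
  then show "expectation (\<lambda>x. exp (l * f x)) \<le> exp (l\<^sup>2 * (b - a)\<^sup>2 / 8)"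
    by simp
qed

section \<open>Counters and empirical means as sums over time\<close>

lemma obs_count_eq_sum:
  "real (obs_count E I k t \<omega>) = (\<Sum>s=1..t. of_bool (k \<in> nbhd E (I s \<omega>)))"
  by (induction t) auto

lemma obs_count_le: "obs_count E I k t \<omega> \<le> t"
  by (induction t) auto

text \<open>Multiplying the running-average update by the new counter cancels its denominators, and
  each observation adds one centred reward. As long as the counter is 0, both sides vanish.\<close>

lemma obs_count_times_emp_mean_deviation:
  "real (obs_count E I k t \<omega>) * (emp_mean E X I k t \<omega> - m)
    = (\<Sum>s=1..t. of_bool (k \<in> nbhd E (I s \<omega>)) * (X k s \<omega> - m))"
proof (induction t)
  case (Suc t)
  let ?o = "real (obs_count E I k t \<omega>)"
  have "(?o + 1) * (X k (Suc t) \<omega> / (?o + 1) + (1 - 1 / (?o + 1)) * emp_mean E X I k t \<omega> - m)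
      = (X k (Suc t) \<omega> - m) + ?o * (emp_mean E X I k t \<omega> - m)"
    by (simp add: divide_simps) (simp add: algebra_simps)?
  with Suc show ?case by (auto simp: add.commute)
qed simp

section \<open>Moments of a single reward\<close>

context side_obs_bandit
begin

lemma AE_X_bounds:
  assumes "i \<in> {1..K}" "t \<ge> 1"
  shows "AE \<omega> in M. X i t \<omega> \<in> {0..1}"
proof (rule AE_distrD[OF X_measurable[OF assms]])
  show "AE x in distr M borel (X i t). x \<in> {0..1}"
    unfolding distr_X[OF assms] by (rule support_P[OF assms(1)])
qed

lemma integrable_X:
  assumes "i \<in> {1..K}" "t \<ge> 1"
  shows "integrable M (X i t)"
  by (rule integrable_const_bound[of _ 1])
    (use AE_X_bounds[OF assms] X_measurable[OF assms] in auto)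

lemma expectation_X:
  assumes "i \<in> {1..K}" "t \<ge> 1"
  shows "expectation (X i t) = arm_mean P i"
  unfolding arm_mean_def distr_X[OF assms, symmetric]
  using X_measurable[OF assms] by (subst integral_distr) auto

text \<open>The centred reward ranges over an interval of length 1, so Hoeffding's lemma bounds its
  exponential moment by \<open>exp (l\<^sup>2 / 8)\<close>; the subtracted term normalises this to
  1.\<close>

lemma expectation_exp_deviation:
  assumes "i \<in> {1..K}" "t \<ge> 1"
  shows "integrable M (\<lambda>\<omega>. exp (l * (X i t \<omega> - arm_mean P i) - l\<^sup>2 / 8))"
    and "expectation (\<lambda>\<omega>. exp (l * (X i t \<omega> - arm_mean P i) - l\<^sup>2 / 8)) \<le> 1"
proof -
  let ?f = "\<lambda>\<omega>. X i t \<omega> - arm_mean P i"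
  have meas: "?f \<in> borel_measurable M" using X_measurable[OF assms] by simp
  have ae: "AE \<omega> in M. ?f \<omega> \<in> {- arm_mean P i..1 - arm_mean P i}"
    using AE_X_bounds[OF assms] by auto
  have E0: "expectation ?f = 0"
    using integrable_X[OF assms] expectation_X[OF assms] by (simp add: prob_space)
  have eq: "exp (l * ?f \<omega> - l\<^sup>2 / 8) = exp (l * ?f \<omega>) * exp (- (l\<^sup>2 / 8))" for \<omega>
    by (simp flip: exp_add)
  show "integrable M (\<lambda>\<omega>. exp (l * ?f \<omega> - l\<^sup>2 / 8))"
    unfolding eq using Hoeffdings_lemma_signed(1)[OF meas ae E0] by simp
  have "expectation (\<lambda>\<omega>. exp (l * ?f \<omega> - l\<^sup>2 / 8))
      = expectation (\<lambda>\<omega>. exp (l * ?f \<omega>)) * exp (- (l\<^sup>2 / 8))"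
    unfolding eq by simp
  also have "\<dots> \<le> exp (l\<^sup>2 / 8) * exp (- (l\<^sup>2 / 8))"
    using Hoeffdings_lemma_signed(2)[OF meas ae E0] by (intro mult_right_mono) auto
  also have "\<dots> = 1" by (simp flip: exp_add)
  finally show "expectation (\<lambda>\<omega>. exp (l * ?f \<omega> - l\<^sup>2 / 8)) \<le> 1" .
qed

end

section \<open>The exponential supermartingale\<close>

context side_obs_policy
begin

lemma I_in_arms: "t \<ge> 1 \<Longrightarrow> \<omega> \<in> space M \<Longrightarrow> I t \<omega> \<in> {1..K}"
  using measurable_space[OF I_measurable_past[of t t], of \<omega>] by simp

lemma I_measurable: "t \<ge> 1 \<Longrightarrow> I t \<in> M \<rightarrow>\<^sub>M count_space {1..K}"
  by (rule past_measurable_imp[OF I_measurable_past]) auto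

lemma pred_I_past: "1 \<le> s \<Longrightarrow> s \<le> t \<Longrightarrow> Measurable.pred (past t) (\<lambda>\<omega>. Q (I s \<omega>))"
  by (rule measurable_compose[OF I_measurable_past]) auto

lemma pred_I: "1 \<le> t \<Longrightarrow> Measurable.pred M (\<lambda>\<omega>. Q (I t \<omega>))"
  by (rule measurable_compose[OF I_measurable]) auto

text \<open>The sum over time exhibits one factor per step, as the supermartingale argument
  requires; \<open>exp_deviation_eq\<close> gives the form in the counter and the empirical
  mean.\<close>

definition exp_deviation :: "real \<Rightarrow> nat \<Rightarrow> nat \<Rightarrow> 'a \<Rightarrow> real" where
  "exp_deviation l k t \<omega> =
    exp (\<Sum>s=1..t. of_bool (k \<in> nbhd E (I s \<omega>)) * (l * (X k s \<omega> - arm_mean P k) - l\<^sup>2 / 8))"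

lemma exp_deviation_pos: "exp_deviation l k t \<omega> > 0"
  by (simp add: exp_deviation_def)

lemma exp_deviation_eq:
  "exp_deviation l k t \<omega> = exp (real (obs_count E I k t \<omega>)
     * (l * (emp_mean E X I k t \<omega> - arm_mean P k) - l\<^sup>2 / 8))"
proof -
  have "real (obs_count E I k t \<omega>) * (l * (emp_mean E X I k t \<omega> - arm_mean P k) - l\<^sup>2 / 8)
    = l * (real (obs_count E I k t \<omega>) * (emp_mean E X I k t \<omega> - arm_mean P k))
      - real (obs_count E I k t \<omega>) * (l\<^sup>2 / 8)"
    by (simp add: algebra_simps)
  also have "\<dots> = (\<Sum>s=1..t. of_bool (k \<in> nbhd E (I s \<omega>)) * (l * (X k s \<omega> - arm_mean P k) - l\<^sup>2 / 8))"
    unfolding obs_count_times_emp_mean_deviation unfolding obs_count_eq_sum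
    unfolding sum_distrib_left sum_distrib_right sum_subtractf[symmetric]
    by (intro sum.cong refl) (simp add: algebra_simps)
  finally show ?thesis by (simp add: exp_deviation_def)
qed

text \<open>The rewards of time \<open>t\<close> occur in the sum, hence the shift to
  \<open>past (Suc t)\<close>.\<close>

lemma exp_deviation_measurable:
  assumes "k \<in> {1..K}"
  shows "exp_deviation l k t \<in> borel_measurable (past (Suc t))"
proof -
  have [measurable]: "X k s \<in> borel_measurable (past (Suc t))"
    "Measurable.pred (past (Suc t)) (\<lambda>\<omega>. k \<in> nbhd E (I s \<omega>))" if "s \<in> {1..t}" for s
    using X_measurable_past[OF assms] that by (auto intro!: pred_I_past)
  show ?thesis unfolding exp_deviation_def[abs_def] by measurable
qed

text \<open>Whether arm \<open>k\<close> is observed at time \<open>t + 1\<close> is decided by the past, so each factor of the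
  exponential is independent of the preceding ones and has mean at most 1.\<close>

lemma exp_deviation_supermartingale:
  assumes k: "k \<in> {1..K}"
  shows "integrable M (exp_deviation l k t) \<and> expectation (exp_deviation l k t) \<le> 1"
proof (induction t)
  case 0
  then show ?case by (simp add: exp_deviation_def[abs_def] prob_space)
next
  case (Suc t)
  define obs where "obs \<omega> \<longleftrightarrow> k \<in> nbhd E (I (Suc t) \<omega>)" for \<omega>
  \<comment> \<open>\<open>Y'\<close> is the part on which the process does not move,
    \<open>Y\<close> the part that is multiplied by the new factor \<open>Z\<close>.\<close>
  define Y where "Y \<omega> = exp_deviation l k t \<omega> * of_bool (obs \<omega>)" for \<omega>
  define Y' where "Y' \<omega> = exp_deviation l k t \<omega> * of_bool (\<not> obs \<omega>)" for \<omega>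
  define Z where "Z \<omega> = exp (l * (X k (Suc t) \<omega> - arm_mean P k) - l\<^sup>2 / 8)" for \<omega>
  have [measurable]: "Measurable.pred (past (Suc t)) obs"
    unfolding obs_def[abs_def] by (rule pred_I_past) auto
  have [measurable]: "Measurable.pred M obs"
    unfolding obs_def[abs_def] by (rule pred_I) auto
  note exp_deviation_measurable[OF k, measurable]
  note past_measurable_imp[OF exp_deviation_measurable[OF k], measurable]
  have Y_meas: "Y \<in> borel_measurable (past (Suc t))"
    unfolding Y_def[abs_def] by measurable
  have Z: "integrable M Z" "expectation Z \<le> 1"
    unfolding Z_def[abs_def] using expectation_exp_deviation[OF k, of "Suc t"] by auto
  have intY: "integrable M Y" "integrable M Y'"
    unfolding Y_def[abs_def] Y'_def[abs_def]
    by (rule Bochner_Integration.integrable_bound[OF conjunct1[OF Suc.IH]]; simp)+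
  \<comment> \<open>\<open>Z\<close> is a function of the reward at time \<open>Suc t\<close> alone,
    while \<open>Y\<close> is determined by the past.\<close>
  have "indep_var borel ((\<lambda>x. exp (l * (x - arm_mean P k) - l\<^sup>2 / 8)) \<circ> X k (Suc t)) borel (id \<circ> Y)"
    by (rule indep_var_compose[OF indep_var_past[OF k _ Y_meas]]) auto
  then have ind: "indep_var borel Z borel Y"
    by (simp add: o_def Z_def[abs_def])
  have step: "exp_deviation l k (Suc t) = (\<lambda>\<omega>. Y' \<omega> + Z \<omega> * Y \<omega>)"
    by (auto simp: exp_deviation_def Y_def Y'_def Z_def obs_def exp_add fun_eq_iff)
  have ZY: "integrable M (\<lambda>\<omega>. Z \<omega> * Y \<omega>)" "expectation (\<lambda>\<omega>. Z \<omega> * Y \<omega>) = expectation Z * expectation Y"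
    using indep_var_integrable[OF ind] indep_var_lebesgue_integral[OF ind] Z intY by auto
  have "expectation (exp_deviation l k (Suc t)) = expectation Y' + expectation Z * expectation Y"
    unfolding step using ZY intY by simp
  also have "\<dots> \<le> expectation Y' + 1 * expectation Y"
    using Z by (intro add_left_mono mult_right_mono integral_nonneg)
      (auto simp: Y_def exp_deviation_def)
  also have "\<dots> = expectation (\<lambda>\<omega>. Y' \<omega> + Y \<omega>)" using intY by simp
  also have "(\<lambda>\<omega>. Y' \<omega> + Y \<omega>) = exp_deviation l k t"
    by (auto simp: Y_def Y'_def fun_eq_iff)
  finally show ?case using Suc.IH ZY intY unfolding step by simp
qed

section \<open>Tail bound for the empirical mean\<close>

lemma emp_mean_measurable:
  assumes "k \<in> {1..K}"
  shows "emp_mean E X I k t \<in> borel_measurable M"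
    and "obs_count E I k t \<in> M \<rightarrow>\<^sub>M count_space UNIV"
proof (induction t)
  case 0
  have "emp_mean E X I k 0 = (\<lambda>_. 0)" "obs_count E I k 0 = (\<lambda>_. 0)" by auto
  then show "emp_mean E X I k 0 \<in> borel_measurable M"
    and "obs_count E I k 0 \<in> M \<rightarrow>\<^sub>M count_space UNIV" by simp_all
next
  case (Suc t)
  note X_measurable[OF assms, of "Suc t", simplified, measurable]
  have [measurable]: "Measurable.pred M (\<lambda>\<omega>. k \<in> nbhd E (I (Suc t) \<omega>))"
    by (rule pred_I) auto
  note Suc.IH[measurable]
  have "obs_count E I k (Suc t) = (\<lambda>\<omega>. if k \<in> nbhd E (I (Suc t) \<omega>)
      then obs_count E I k t \<omega> + 1 else obs_count E I k t \<omega>)"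
    by auto
  then show count [measurable]: "obs_count E I k (Suc t) \<in> M \<rightarrow>\<^sub>M count_space UNIV"
    by simp
  have [measurable]: "(\<lambda>\<omega>. real (obs_count E I k (Suc t) \<omega>)) \<in> borel_measurable M"
    by (rule measurable_compose[OF count]) auto
  have "emp_mean E X I k (Suc t) = (\<lambda>\<omega>. if k \<in> nbhd E (I (Suc t) \<omega>)
     then X k (Suc t) \<omega> / real (obs_count E I k (Suc t) \<omega>)
       + (1 - 1 / real (obs_count E I k (Suc t) \<omega>)) * emp_mean E X I k t \<omega>
     else emp_mean E X I k t \<omega>)"
    by auto
  then show "emp_mean E X I k (Suc t) \<in> borel_measurable M"
    by (simp del: obs_count.simps)
qed

lemma emp_mean_tail:
  assumes k: "k \<in> {1..K}" and c: "c \<ge> 0" and \<sigma>: "\<sigma> = 1 \<or> \<sigma> = (- 1 :: real)"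
  shows "prob {\<omega> \<in> space M. obs_count E I k t \<omega> = s \<and> \<sigma> * (emp_mean E X I k t \<omega> - arm_mean P k) \<ge> c}
    \<le> exp (- 2 * real s * c\<^sup>2)"
proof -
  \<comment> \<open>The value \<open>4 * c\<close> maximises \<open>l * c - l\<^sup>2 / 8\<close>,
    with maximum \<open>2 * c\<^sup>2\<close>; the sign \<open>\<sigma>\<close> selects the
    tail.\<close>
  let ?l = "4 * c * \<sigma>"
  have \<sigma>2: "\<sigma>\<^sup>2 = 1" using \<sigma> by auto
  have "{\<omega> \<in> space M. obs_count E I k t \<omega> = s \<and> \<sigma> * (emp_mean E X I k t \<omega> - arm_mean P k) \<ge> c}
      \<subseteq> {\<omega> \<in> space M. exp_deviation ?l k t \<omega> \<ge> exp (2 * real s * c\<^sup>2)}"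
  proof safe
    fix \<omega> assume *: "c \<le> \<sigma> * (emp_mean E X I k t \<omega> - arm_mean P k)"
    let ?s = "real (obs_count E I k t \<omega>)"
    have "4 * c * c \<le> 4 * c * (\<sigma> * (emp_mean E X I k t \<omega> - arm_mean P k))"
      using * c by (intro mult_left_mono) auto
    moreover have "?l\<^sup>2 / 8 = 2 * c\<^sup>2" using \<sigma>2 by (simp add: power_mult_distrib)
    ultimately have "2 * c\<^sup>2 \<le> ?l * (emp_mean E X I k t \<omega> - arm_mean P k) - ?l\<^sup>2 / 8"
      by (simp only: power2_eq_square mult.assoc)
    then have "?s * (2 * c\<^sup>2) \<le> ?s * (?l * (emp_mean E X I k t \<omega> - arm_mean P k) - ?l\<^sup>2 / 8)"
      by (intro mult_left_mono) auto
    then show "exp (2 * ?s * c\<^sup>2) \<le> exp_deviation ?l k t \<omega>"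
      unfolding exp_deviation_eq by (simp add: mult_ac)
  qed
  then have "prob {\<omega> \<in> space M. obs_count E I k t \<omega> = s \<and> \<sigma> * (emp_mean E X I k t \<omega> - arm_mean P k) \<ge> c}
      \<le> prob {\<omega> \<in> space M. exp_deviation ?l k t \<omega> \<ge> exp (2 * real s * c\<^sup>2)}"
    using past_measurable_imp[OF exp_deviation_measurable[OF k]]
    by (intro finite_measure_mono) auto
  also have "\<dots> \<le> expectation (exp_deviation ?l k t) / exp (2 * real s * c\<^sup>2)"
    using exp_deviation_supermartingale[OF k]
    by (intro integral_Markov_inequality_measure[where A="{}"])
      (auto intro!: AE_I2 simp: less_imp_le[OF exp_deviation_pos])
  also have "\<dots> \<le> 1 / exp (2 * real s * c\<^sup>2)"
    using exp_deviation_supermartingale[OF k] by (intro divide_right_mono) auto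
  finally show ?thesis by (simp add: exp_minus field_simps)
qed

text \<open>The choice of the arm at time \<open>t\<close> depends on the past only, so the event
  \<open>I t \<omega> = i\<close> is independent of \<open>X i t\<close>. Splitting over the pulled
  arm lets each reward be replaced by its mean.\<close>

lemma integrable_regret_terms:
  assumes t: "t \<ge> 1"
  shows "integrable M (\<lambda>\<omega>. X (I t \<omega>) t \<omega>)"
    and "expectation (\<lambda>\<omega>. X (I t \<omega>) t \<omega>) = expectation (\<lambda>\<omega>. arm_mean P (I t \<omega>))"
    and "integrable M (\<lambda>\<omega>. f (I t \<omega>) :: real)"
proof -
  have ind: "indep_var borel (X i t) borel (\<lambda>\<omega>. of_bool (I t \<omega> = i) :: real)" if "i \<in> {1..K}" for i
    by (rule indep_var_past[OF that t], rule measurable_compose[OF I_measurable_past[OF t order_refl]]) auto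
  have int_b: "integrable M (\<lambda>\<omega>. of_bool (I t \<omega> = i) :: real)" for i
    using pred_I[OF t, of "\<lambda>j. j = i"] by (intro integrable_const_bound[of _ 1]) auto
  have int_X: "integrable M (\<lambda>\<omega>. X i t \<omega> * of_bool (I t \<omega> = i))" if "i \<in> {1..K}" for i
    using indep_var_integrable[OF ind[OF that] integrable_X[OF that t] int_b] .
  have E_X: "expectation (\<lambda>\<omega>. X i t \<omega> * of_bool (I t \<omega> = i))
      = arm_mean P i * expectation (\<lambda>\<omega>. of_bool (I t \<omega> = i))" if "i \<in> {1..K}" for i
    using indep_var_lebesgue_integral[OF ind[OF that] integrable_X[OF that t] int_b]
    by (simp add: expectation_X[OF that t])
  have decomp: "g (I t \<omega>) = (\<Sum>i=1..K. g i * of_bool (I t \<omega> = i))" if "\<omega> \<in> space M"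
    for g :: "nat \<Rightarrow> real" and \<omega>
    using I_in_arms[OF t that] by (simp add: of_bool_def if_distrib cong: if_cong)
  show "integrable M (\<lambda>\<omega>. X (I t \<omega>) t \<omega>)"
    by (subst Bochner_Integration.integrable_cong[OF refl decomp])
      (assumption, rule Bochner_Integration.integrable_sum, rule int_X)
  show "integrable M (\<lambda>\<omega>. f (I t \<omega>) :: real)"
    by (subst Bochner_Integration.integrable_cong[OF refl decomp])
      (assumption, intro Bochner_Integration.integrable_sum integrable_mult_right int_b)
  have "expectation (\<lambda>\<omega>. X (I t \<omega>) t \<omega>) = expectation (\<lambda>\<omega>. \<Sum>i=1..K. X i t \<omega> * of_bool (I t \<omega> = i))"
    by (rule Bochner_Integration.integral_cong[OF refl decomp])
  also have "\<dots> = (\<Sum>i=1..K. arm_mean P i * expectation (\<lambda>\<omega>. of_bool (I t \<omega> = i)))"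
    using int_X E_X by (subst Bochner_Integration.integral_sum) auto
  also have "\<dots> = expectation (\<lambda>\<omega>. \<Sum>i=1..K. arm_mean P i * of_bool (I t \<omega> = i))"
    using int_b by (subst Bochner_Integration.integral_sum) auto
  also have "\<dots> = expectation (\<lambda>\<omega>. arm_mean P (I t \<omega>))"
    by (rule Bochner_Integration.integral_cong[OF refl decomp[symmetric]])
  finally show "expectation (\<lambda>\<omega>. X (I t \<omega>) t \<omega>) = expectation (\<lambda>\<omega>. arm_mean P (I t \<omega>))" .
qed

text \<open>The gaps are summed over time rather than over arms, since the later counting argument
  charges the pulls one by one along each path.\<close>

lemma expectation_regret:
  assumes "istar \<in> {1..K}"
  shows "expectation (regret X I istar n) = expectation (\<lambda>\<omega>. \<Sum>t=1..n. gap P istar (I t \<omega>))"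
proof -
  have "expectation (regret X I istar n)
      = (\<Sum>t=1..n. arm_mean P istar) - (\<Sum>t=1..n. expectation (\<lambda>\<omega>. arm_mean P (I t \<omega>)))"
    unfolding regret_def[abs_def]
    using integrable_X[OF assms] expectation_X[OF assms] integrable_regret_terms(1,2)
    by (subst Bochner_Integration.integral_diff)
      (auto simp: Bochner_Integration.integral_sum)
  also have "\<dots> = (\<Sum>t=1..n. expectation (\<lambda>\<omega>. gap P istar (I t \<omega>)))"
    unfolding gap_def sum_subtractf[symmetric] using integrable_regret_terms(3)
    by (intro sum.cong refl) (simp add: prob_space)
  finally show ?thesis
    using integrable_regret_terms(3) by (subst Bochner_Integration.integral_sum) auto
qed

end


section \<open>Pulls of suboptimal arms\<close>

text \<open>The number of predecessors strictly increases along the times satisfying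
  \<open>Q\<close>, so it maps the set injectively into the naturals below \<open>L\<close>. There
  are at most \<open>\<lceil>L\<rceil>\<close> of these, which accounts for the extra 1.\<close>

lemma card_few_predecessors_le:
  fixes n :: nat and L :: real
  assumes "L \<ge> 0"
  shows "real (card {t \<in> {1..n}. Q t \<and> real (card {s \<in> {1..<t}. Q s}) < L}) \<le> L + 1"
proof -
  let ?A = "{t \<in> {1..n}. Q t \<and> real (card {s \<in> {1..<t}. Q s}) < L}"
  let ?f = "\<lambda>t. card {s \<in> {1..<t}. Q s}"
  have less: "?f t < ?f t'" if "t \<in> ?A" "t < t'" for t t'
  proof (intro psubset_card_mono psubsetI)
    have "t \<in> {s \<in> {1..<t'}. Q s}" "t \<notin> {s \<in> {1..<t}. Q s}" using that by simp_all
    then show "{s \<in> {1..<t}. Q s} \<noteq> {s \<in> {1..<t'}. Q s}" by metis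
    show "{s \<in> {1..<t}. Q s} \<subseteq> {s \<in> {1..<t'}. Q s}" using that(2) by auto
  qed simp
  have "inj_on ?f ?A"
  proof (rule inj_onI)
    fix t t' assume "t \<in> ?A" "t' \<in> ?A" "?f t = ?f t'"
    then show "t = t'"
      using less[of t t'] less[of t' t] by (metis linorder_neq_iff)
  qed
  moreover have "?f ` ?A \<subseteq> {..<nat \<lceil>L\<rceil>}"
    by (auto simp: less_ceiling_iff zless_nat_eq_int_zless)
  ultimately have "card ?A \<le> nat \<lceil>L\<rceil>"
    using card_inj_on_le[of ?f ?A "{..<nat \<lceil>L\<rceil>}"] by simp
  then show ?thesis using assms by linarith
qed

lemma gap_nonneg:
  assumes "is_arg_max (arm_mean P) (\<lambda>i. i \<in> {1..K}) istar" and "i \<in> {1..K}"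
  shows "gap P istar i \<ge> 0"
  using assms by (auto simp: is_arg_max_def gap_def not_less)

section \<open>Pulling a well observed suboptimal arm is unlikely\<close>

context ucb_n
begin

text \<open>If both alternatives fail, the optimal mean lies below the index of
  \<open>istar\<close>, which is at most the index of \<open>i\<close>, which lies below the mean of
  \<open>i\<close> plus two radii. So the gap is less than twice the radius, and \<open>i\<close>
  has fewer than \<open>8 * ln t / gap\<^sup>2\<close> observations. The threshold \<open>L\<close>
  is only bounded from below, because one value will serve all times up to \<open>n\<close>.\<close>

lemma deviation_of_pull:
  assumes istar: "istar \<in> {1..K}" and i: "i \<in> {1..K}" and t: "t \<ge> 1" and \<omega>: "\<omega> \<in> space M"
    and gap: "gap P istar i > 0" and L: "L > 0" "8 * ln (real t) / (gap P istar i)\<^sup>2 \<le> L"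
    and pull: "I t \<omega> = i" and obs: "real (obs_count E I i (t - 1) \<omega>) \<ge> L"
  shows "emp_mean E X I i (t - 1) \<omega> - arm_mean P i
        \<ge> sqrt (2 * ln (real t) / real (obs_count E I i (t - 1) \<omega>))
    \<or> obs_count E I istar (t - 1) \<omega> > 0 \<and> - (emp_mean E X I istar (t - 1) \<omega> - arm_mean P istar)
        \<ge> sqrt (2 * ln (real t) / real (obs_count E I istar (t - 1) \<omega>))"
proof (rule ccontr)
  let ?s = "real (obs_count E I i (t - 1) \<omega>)"
  let ?c = "sqrt (2 * ln (real t) / ?s)"
  assume *: "\<not> ?thesis"
  have s: "?s > 0" using L obs by linarith
  have "\<not> ucb_index E X I t \<omega> istar > ucb_index E X I t \<omega> i"
    using ucb_argmax[OF t \<omega>] istar pull by (auto simp: is_arg_max_def)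
  \<comment> \<open>An unobserved optimal arm would have index \<open>\<infinity>\<close> and beat
    the finite index of \<open>i\<close>. The radius formula itself would give 0 there, so
    positivity must be recorded separately.\<close>
  then have "obs_count E I istar (t - 1) \<omega> > 0"
    and "emp_mean E X I istar (t - 1) \<omega> + sqrt (2 * ln (real t) / real (obs_count E I istar (t - 1) \<omega>))
      \<le> emp_mean E X I i (t - 1) \<omega> + ?c"
    using s by (auto simp: ucb_index_def split: if_splits)
  with * have "gap P istar i < 2 * ?c" by (auto simp: gap_def)
  then have "(gap P istar i)\<^sup>2 < (2 * ?c)\<^sup>2"
    using gap by (intro power_strict_mono) auto
  also have "\<dots> = 8 * ln (real t) / ?s"
    using s t by (simp add: power_mult_distrib)
  finally have "?s < 8 * ln (real t) / (gap P istar i)\<^sup>2"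
    using s gap by (simp add: field_simps)
  with L obs show False by linarith
qed

text \<open>The counters are random and depend on the rewards, so a union bound runs over their
  possible values, for the upper tail of \<open>i\<close> and the lower tail of
  \<open>istar\<close>.\<close>

lemma prob_pull_suboptimal:
  assumes istar: "istar \<in> {1..K}" and i: "i \<in> {1..K}" and t: "t \<ge> 1"
    and gap: "gap P istar i > 0" and L: "L > 0" "8 * ln (real t) / (gap P istar i)\<^sup>2 \<le> L"
  shows "prob {\<omega> \<in> space M. I t \<omega> = i \<and> real (obs_count E I i (t - 1) \<omega>) \<ge> L} \<le> 2 / (real t)\<^sup>2"
proof -
  define c where "c s = sqrt (2 * ln (real t) / real s)" for s
  define D where "D k \<sigma> s = {\<omega> \<in> space M. obs_count E I k (t - 1) \<omega> = s \<and>
      \<sigma> * (emp_mean E X I k (t - 1) \<omega> - arm_mean P k) \<ge> c s}" for k s and \<sigma> :: real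
  have D_sets: "D k \<sigma> s \<in> events" if "k \<in> {1..K}" for k \<sigma> s
    unfolding D_def using emp_mean_measurable[OF that] by measurable
  have D_prob: "prob (D k \<sigma> s) \<le> 1 / real t ^ 4"
    if "k \<in> {1..K}" "\<sigma> = 1 \<or> \<sigma> = (- 1 :: real)" "s \<in> {1..t - 1}" for k \<sigma> s
  proof -
    have "prob (D k \<sigma> s) \<le> exp (- 2 * real s * (c s)\<^sup>2)"
      unfolding D_def by (rule emp_mean_tail) (use that t in \<open>auto simp: c_def\<close>)
    \<comment> \<open>The radius is chosen so that \<open>s\<close> cancels: the exponent is
      \<open>- 4 * ln t\<close> for every \<open>s\<close>.\<close>
    also have "- 2 * real s * (c s)\<^sup>2 = - (real 4 * ln (real t))"
      using that t by (simp add: c_def)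
    also have "exp (- (real 4 * ln (real t))) = 1 / real t ^ 4"
      using t by (simp only: exp_minus exp_of_nat_mult) (simp add: field_simps)
    finally show ?thesis .
  qed
  have D_Union: "prob (\<Union>s\<in>{1..t - 1}. D k \<sigma> s) \<le> real (t - 1) * (1 / real t ^ 4)"
    if "k \<in> {1..K}" "\<sigma> = 1 \<or> \<sigma> = (- 1 :: real)" for k \<sigma>
  proof -
    have "prob (\<Union>s\<in>{1..t - 1}. D k \<sigma> s) \<le> (\<Sum>s\<in>{1..t - 1}. prob (D k \<sigma> s))"
      by (rule finite_measure_subadditive_finite) (use D_sets that in auto)
    also have "\<dots> \<le> (\<Sum>s\<in>{1..t - 1}. 1 / real t ^ 4)"
      by (rule sum_mono) (use D_prob that in auto)
    finally show ?thesis by simp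
  qed
  have D_Union_sets: "(\<Union>s\<in>{1..t - 1}. D k \<sigma> s) \<in> events" if "k \<in> {1..K}" for k \<sigma>
    using D_sets[OF that] by auto
  have "{\<omega> \<in> space M. I t \<omega> = i \<and> real (obs_count E I i (t - 1) \<omega>) \<ge> L}
      \<subseteq> (\<Union>s\<in>{1..t - 1}. D i 1 s) \<union> (\<Union>s\<in>{1..t - 1}. D istar (- 1) s)"
  proof (rule subsetI, elim CollectE conjE)
    fix \<omega> assume \<omega>: "\<omega> \<in> space M" and pull: "I t \<omega> = i" and obs: "real (obs_count E I i (t - 1) \<omega>) \<ge> L"
    \<comment> \<open>Positivity of \<open>L\<close> excludes the value 0, and counters after time
      \<open>t - 1\<close> are at most \<open>t - 1\<close>; this gives the range of
      \<open>s\<close>.\<close>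
    have "obs_count E I i (t - 1) \<omega> > 0" using L(1) obs by (cases "obs_count E I i (t - 1) \<omega>") auto
    then show "\<omega> \<in> (\<Union>s\<in>{1..t - 1}. D i 1 s) \<union> (\<Union>s\<in>{1..t - 1}. D istar (- 1) s)"
      using deviation_of_pull[OF istar i t \<omega> gap L pull obs] \<omega>
        obs_count_le[of E I i "t - 1" \<omega>] obs_count_le[of E I istar "t - 1" \<omega>]
      by (auto simp: D_def c_def)
  qed
  then have "prob {\<omega> \<in> space M. I t \<omega> = i \<and> real (obs_count E I i (t - 1) \<omega>) \<ge> L}
      \<le> prob ((\<Union>s\<in>{1..t - 1}. D i 1 s) \<union> (\<Union>s\<in>{1..t - 1}. D istar (- 1) s))"
    using D_Union_sets i istar by (intro finite_measure_mono) auto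
  also have "\<dots> \<le> prob (\<Union>s\<in>{1..t - 1}. D i 1 s) + prob (\<Union>s\<in>{1..t - 1}. D istar (- 1) s)"
    using D_Union_sets i istar by (intro measure_Un_le) auto
  also have "\<dots> \<le> real (t - 1) * (1 / real t ^ 4) + real (t - 1) * (1 / real t ^ 4)"
    using D_Union i istar by (intro add_mono) auto
  also have "\<dots> = 2 * (real (t - 1) / real t ^ 4)" by simp
  also have "\<dots> \<le> 2 * ((real t)\<^sup>2 / real t ^ 4)"
  proof (intro mult_left_mono divide_right_mono)
    have "real t * 1 \<le> real t * real t" using t by (intro mult_left_mono) auto
    then show "real (t - 1) \<le> (real t)\<^sup>2" unfolding power2_eq_square by linarith
  qed auto
  also have "\<dots> = 2 / (real t)\<^sup>2"
    using t by (simp add: divide_simps flip: power_add)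
  finally show ?thesis .
qed

text \<open>An earlier pull of an arm assigned to \<open>\<kappa> i\<close> is a pull of
  \<open>i\<close> itself or of a neighbour of \<open>i\<close>, as both lie in one clique; either
  way \<open>i\<close> is observed.\<close>

lemma card_clique_pulls_le_obs_count:
  assumes cl: "\<And>j. j \<in> {1..K} \<Longrightarrow> \<kappa> j = \<kappa> i \<Longrightarrow> j \<in> \<kappa> i" and "clique (\<kappa> i) E" "i \<in> \<kappa> i" "\<omega> \<in> space M"
  shows "card {s \<in> {1..<t}. \<kappa> (I s \<omega>) = \<kappa> i} \<le> obs_count E I i (t - 1) \<omega>"
proof -
  have "i \<in> nbhd E (I s \<omega>)" if "s \<in> {1..<t}" "\<kappa> (I s \<omega>) = \<kappa> i" for s
    using cl[of "I s \<omega>"] I_in_arms[of s \<omega>] that assms(2-4)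
    by (auto simp: nbhd_def clique_def)
  then have "card {s \<in> {1..<t}. \<kappa> (I s \<omega>) = \<kappa> i} \<le> card {s \<in> {1..t - 1}. i \<in> nbhd E (I s \<omega>)}"
    by (intro card_mono) auto
  also have "real \<dots> = real (obs_count E I i (t - 1) \<omega>)"
    unfolding obs_count_eq_sum by (simp add: Int_def)
  finally show ?thesis by simp
qed

text \<open>On each path, a pull is charged to its class \<open>C\<close> if that class has had
  fewer than \<open>L C\<close> pulls, which happens at most \<open>L C + 1\<close> times at cost at
  most \<open>m C\<close>. Otherwise the pulled arm has been observed at least \<open>L C\<close>
  times, and its gap is charged to the last sum.\<close>

lemma sum_pulls_le:
  fixes \<Delta> :: "nat \<Rightarrow> real" and m L :: "nat set \<Rightarrow> real"
  assumes \<kappa>: "\<And>i. i \<in> {1..K} \<Longrightarrow> \<kappa> i \<in> \<C> \<and> i \<in> \<kappa> i"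
    and \<C>: "finite \<C>" "\<And>C. C \<in> \<C> \<Longrightarrow> clique C E"
    and m: "\<And>i. i \<in> {1..K} \<Longrightarrow> 0 \<le> \<Delta> i \<and> \<Delta> i \<le> m (\<kappa> i)" "\<And>C. C \<in> \<C> \<Longrightarrow> m C \<ge> 0"
    and L: "\<And>C. C \<in> \<C> \<Longrightarrow> L C \<ge> 0" and \<omega>: "\<omega> \<in> space M"
  shows "(\<Sum>t=1..n. \<Delta> (I t \<omega>)) \<le> (\<Sum>C\<in>\<C>. m C * (L C + 1))
    + (\<Sum>t=1..n. \<Sum>i=1..K. \<Delta> i * of_bool (I t \<omega> = i \<and> real (obs_count E I i (t - 1) \<omega>) \<ge> L (\<kappa> i)))"
proof -
  define few where "few C t \<longleftrightarrow> \<kappa> (I t \<omega>) = C \<and> real (card {s \<in> {1..<t}. \<kappa> (I s \<omega>) = C}) < L C" for C t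
  define many where "many i t \<longleftrightarrow> I t \<omega> = i \<and> real (obs_count E I i (t - 1) \<omega>) \<ge> L (\<kappa> i)" for i t
  have "\<Delta> (I t \<omega>) \<le> (\<Sum>C\<in>\<C>. m C * of_bool (few C t)) + (\<Sum>i=1..K. \<Delta> i * of_bool (many i t))"
    if t: "t \<in> {1..n}" for t
  proof -
    let ?i = "I t \<omega>"
    have i: "?i \<in> {1..K}" using I_in_arms[of t \<omega>] t \<omega> by simp
    have nn: "0 \<le> (\<Sum>C\<in>\<C>. m C * of_bool (few C t))" "0 \<le> (\<Sum>i=1..K. \<Delta> i * of_bool (many i t))"
      using m by (auto intro!: sum_nonneg simp del: sum_mult_of_bool_eq)
    show ?thesis
    proof (cases "few (\<kappa> ?i) t")
      case True
      have "m (\<kappa> ?i) * of_bool (few (\<kappa> ?i) t) \<le> (\<Sum>C\<in>\<C>. m C * of_bool (few C t))"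
        using \<kappa>[OF i] \<C> m by (intro member_le_sum) auto
      with True m(1)[OF i] nn show ?thesis by (simp del: sum_mult_of_bool_eq)
    next
      case False
      then have "L (\<kappa> ?i) \<le> real (card {s \<in> {1..<t}. \<kappa> (I s \<omega>) = \<kappa> ?i})"
        by (simp add: few_def)
      also have "\<dots> \<le> real (obs_count E I ?i (t - 1) \<omega>)"
      proof (rule of_nat_mono, rule card_clique_pulls_le_obs_count)
        show "j \<in> \<kappa> ?i" if "j \<in> {1..K}" "\<kappa> j = \<kappa> ?i" for j
          using \<kappa>[OF that(1)] that(2) by simp
      qed (use \<kappa>[OF i] \<C>(2) \<omega> in auto)
      finally have "many ?i t" by (simp add: many_def)
      moreover have "\<Delta> ?i * of_bool (many ?i t) \<le> (\<Sum>i=1..K. \<Delta> i * of_bool (many i t))"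
        using i m by (intro member_le_sum) auto
      ultimately show ?thesis using nn by (simp del: sum_mult_of_bool_eq)
    qed
  qed
  then have "(\<Sum>t=1..n. \<Delta> (I t \<omega>)) \<le> (\<Sum>t=1..n. \<Sum>C\<in>\<C>. m C * of_bool (few C t))
      + (\<Sum>t=1..n. \<Sum>i=1..K. \<Delta> i * of_bool (many i t))"
    unfolding sum.distrib[symmetric] by (rule sum_mono)
  also have "(\<Sum>t=1..n. \<Sum>C\<in>\<C>. m C * of_bool (few C t)) = (\<Sum>C\<in>\<C>. m C * (\<Sum>t=1..n. of_bool (few C t)))"
    unfolding sum_distrib_left by (rule sum.swap)
  also have "\<dots> \<le> (\<Sum>C\<in>\<C>. m C * (L C + 1))"
  proof (intro sum_mono mult_left_mono m)
    fix C assume "C \<in> \<C>"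
    have "(\<Sum>t=1..n. of_bool (few C t)) = real (card {t \<in> {1..n}. few C t})"
      by (simp add: Int_def)
    also have "\<dots> \<le> L C + 1"
      unfolding few_def by (rule card_few_predecessors_le[OF L[OF \<open>C \<in> \<C>\<close>]])
    finally show "(\<Sum>t=1..n. of_bool (few C t)) \<le> L C + 1" .
  qed
  finally show ?thesis by (simp add: many_def)
qed

text \<open>Taking expectations in the pathwise bound turns the second sum into probabilities of at
  most \<open>2 / t\<^sup>2\<close>, whose sum over \<open>t\<close> is controlled by the series of
  inverse squares.\<close>

lemma expected_sum_pulls_le:
  fixes L :: "nat set \<Rightarrow> real" and m :: "nat set \<Rightarrow> real"
  assumes istar: "istar \<in> {1..K}"
    and \<kappa>: "\<And>i. i \<in> {1..K} \<Longrightarrow> \<kappa> i \<in> \<C> \<and> i \<in> \<kappa> i"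
    and \<C>: "finite \<C>" "\<And>C. C \<in> \<C> \<Longrightarrow> clique C E"
    and m: "\<And>i. i \<in> {1..K} \<Longrightarrow> 0 \<le> gap P istar i \<and> gap P istar i \<le> m (\<kappa> i)" "\<And>C. C \<in> \<C> \<Longrightarrow> m C \<ge> 0"
    and L: "\<And>C. C \<in> \<C> \<Longrightarrow> L C \<ge> 0"
      "\<And>i. i \<in> {1..K} \<Longrightarrow> gap P istar i > 0 \<Longrightarrow>
        L (\<kappa> i) > 0 \<and> 8 * ln (real n) / (gap P istar i)\<^sup>2 \<le> L (\<kappa> i)"
  shows "expectation (\<lambda>\<omega>. \<Sum>t=1..n. gap P istar (I t \<omega>))
    \<le> (\<Sum>C\<in>\<C>. m C * (L C + 1)) + pi\<^sup>2 / 3 * (\<Sum>i=1..K. gap P istar i)"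
proof -
  define A where "A t i = {\<omega> \<in> space M. I t \<omega> = i \<and> real (obs_count E I i (t - 1) \<omega>) \<ge> L (\<kappa> i)}" for t i
  have A_sets: "A t i \<in> events" if "t \<in> {1..n}" "i \<in> {1..K}" for t i
  proof -
    have [measurable]: "Measurable.pred M (\<lambda>\<omega>. I t \<omega> = i)" using that by (intro pred_I) auto
    note emp_mean_measurable(2)[OF that(2), measurable]
    show ?thesis unfolding A_def by measurable
  qed
  have int_A: "integrable M (indicator (A t i) :: 'a \<Rightarrow> real)" if "t \<in> {1..n}" "i \<in> {1..K}" for t i
    using A_sets[OF that] by (simp add: emeasure_eq_measure)
  have term_le: "gap P istar i * prob (A t i) \<le> gap P istar i * (2 / (real t)\<^sup>2)"
    if t: "t \<in> {1..n}" and i: "i \<in> {1..K}" for t i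
  \<comment> \<open>For a positive gap, monotonicity of \<open>ln\<close> makes the threshold for
    \<open>n\<close> valid at every \<open>t \<le> n\<close>; a zero gap contributes
    nothing.\<close>
  proof (cases "gap P istar i > 0")
    case True
    have "8 * ln (real t) / (gap P istar i)\<^sup>2 \<le> 8 * ln (real n) / (gap P istar i)\<^sup>2"
      using t by (intro divide_right_mono mult_left_mono) auto
    also have "\<dots> \<le> L (\<kappa> i)" using L(2)[OF i True] by simp
    finally show ?thesis
      unfolding A_def using prob_pull_suboptimal[OF istar i _ True] L(2)[OF i True] t True
      by (intro mult_left_mono) auto
  next
    case False
    then show ?thesis using m(1)[OF i] by simp
  qed
  have sq: "(\<Sum>t=1..n. 2 / (real t)\<^sup>2) \<le> pi\<^sup>2 / 3"
  proof -
    have "(\<Sum>t=1..n. 1 / (real t)\<^sup>2) = (\<Sum>t<n. 1 / (real t + 1)\<^sup>2)"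
      by (rule sum.reindex_bij_witness[of _ Suc "\<lambda>t. t - 1"]) (auto simp: of_nat_diff)
    also have "\<dots> \<le> pi\<^sup>2 / 6"
      using sum_le_suminf[OF sums_summable[OF inverse_squares_sums], of "{..<n}"]
        sums_unique[OF inverse_squares_sums] by (simp add: add.commute)
    finally have "2 * (\<Sum>t=1..n. 1 / (real t)\<^sup>2) \<le> 2 * (pi\<^sup>2 / 6)"
      by (rule mult_left_mono) simp
    then show ?thesis by (simp add: sum_distrib_left)
  qed
  have int_S: "integrable M (\<lambda>\<omega>. \<Sum>t=1..n. \<Sum>i=1..K. gap P istar i * indicator (A t i) \<omega>)"
    using int_A by (intro Bochner_Integration.integrable_sum integrable_mult_right) auto
  have "expectation (\<lambda>\<omega>. \<Sum>t=1..n. gap P istar (I t \<omega>))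
    \<le> expectation (\<lambda>\<omega>. (\<Sum>C\<in>\<C>. m C * (L C + 1))
      + (\<Sum>t=1..n. \<Sum>i=1..K. gap P istar i * indicator (A t i) \<omega>))"
  proof (rule integral_mono)
    show "integrable M (\<lambda>\<omega>. \<Sum>t=1..n. gap P istar (I t \<omega>))"
      by (intro Bochner_Integration.integrable_sum integrable_regret_terms(3)) auto
    fix \<omega> assume \<omega>: "\<omega> \<in> space M"
    show "(\<Sum>t=1..n. gap P istar (I t \<omega>)) \<le> (\<Sum>C\<in>\<C>. m C * (L C + 1))
      + (\<Sum>t=1..n. \<Sum>i=1..K. gap P istar i * indicator (A t i) \<omega>)"
      using sum_pulls_le[of \<kappa> \<C> "gap P istar" m L \<omega> n, OF \<kappa> \<C> m L(1) \<omega>] \<omega>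
      by (simp add: A_def indicator_def of_bool_def)
  qed (use int_S in simp)
  also have "\<dots> = (\<Sum>C\<in>\<C>. m C * (L C + 1)) + (\<Sum>t=1..n. \<Sum>i=1..K. gap P istar i * prob (A t i))"
  proof -
    have "expectation (\<lambda>\<omega>. \<Sum>t=1..n. \<Sum>i=1..K. gap P istar i * indicator (A t i) \<omega>)
        = (\<Sum>t=1..n. \<Sum>i=1..K. gap P istar i * prob (A t i))"
      (is "expectation (\<lambda>\<omega>. \<Sum>t=1..n. ?g t \<omega>) = _")
    proof -
      have "expectation (\<lambda>\<omega>. \<Sum>t=1..n. ?g t \<omega>) = (\<Sum>t=1..n. expectation (?g t))"
        using int_A
        by (intro Bochner_Integration.integral_sum Bochner_Integration.integrable_sum integrable_mult_right) auto
      also have "\<dots> = (\<Sum>t=1..n. \<Sum>i=1..K. gap P istar i * prob (A t i))"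
      proof (rule sum.cong[OF refl])
        fix t assume t: "t \<in> {1..n}"
        have "expectation (?g t) = (\<Sum>i=1..K. expectation (\<lambda>\<omega>. gap P istar i * indicator (A t i) \<omega>))"
          using int_A t by (intro Bochner_Integration.integral_sum integrable_mult_right) auto
        also have "\<dots> = (\<Sum>i=1..K. gap P istar i * prob (A t i))"
          using A_sets[OF t] by (intro sum.cong refl) simp
        finally show "expectation (?g t) = (\<Sum>i=1..K. gap P istar i * prob (A t i))" .
      qed
      finally show ?thesis .
    qed
    with int_S show ?thesis by (simp add: prob_space)
  qed
  also have "(\<Sum>t=1..n. \<Sum>i=1..K. gap P istar i * prob (A t i))
      \<le> (\<Sum>t=1..n. \<Sum>i=1..K. gap P istar i * (2 / (real t)\<^sup>2))"
    by (intro sum_mono term_le)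
  also have "\<dots> = (\<Sum>t=1..n. 2 / (real t)\<^sup>2) * (\<Sum>i=1..K. gap P istar i)"
    unfolding sum_product by (simp only: mult.commute)
  also have "\<dots> \<le> pi\<^sup>2 / 3 * (\<Sum>i=1..K. gap P istar i)"
    using sq m(1) by (intro mult_right_mono sum_nonneg) auto
  finally show ?thesis by simp
qed

text \<open>The cliques of a covering may overlap; assigning each arm to a single clique containing it
  makes the sum of the maximal gaps of the classes at most the sum of all gaps.\<close>

lemma expected_regret_le_covering:
  assumes istar: "is_arg_max (arm_mean P) (\<lambda>i. i \<in> {1..K}) istar"
    and \<C>: "\<C> \<in> clique_coverings {1..K} E" and n: "n \<ge> 2"
    and zero: "\<And>C. C \<in> \<C> \<Longrightarrow> clique_gap (gap P istar) C = 0 \<Longrightarrow> Max (gap P istar ` C) = 0"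
  shows "expectation (regret X I istar n)
    \<le> 8 * (\<Sum>C\<in>\<C>. Max (gap P istar ` C) / (clique_gap (gap P istar) C)\<^sup>2) * ln (real n)
      + (1 + pi\<^sup>2 / 3) * (\<Sum>i=1..K. gap P istar i)"
proof -
  let ?\<Delta> = "gap P istar"
  have istar_in: "istar \<in> {1..K}" using istar by (simp add: is_arg_max_def)
  note \<Delta>_nonneg = gap_nonneg[OF istar]
  have clq: "C \<subseteq> {1..K}" "C \<noteq> {}" "clique C E" if "C \<in> \<C>" for C
    using \<C> that by (auto simp: clique_coverings_def)
  have fin: "finite \<C>"
    using clq by (intro finite_subset[of \<C> "Pow {1..K}"]) auto
  have finC: "finite C" if "C \<in> \<C>" for C
    using clq(1)[OF that] by (rule finite_subset) simp
  have "\<exists>C\<in>\<C>. i \<in> C" if "i \<in> {1..K}" for i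
    using \<C> that by (auto simp: clique_coverings_def)
  then obtain \<kappa> where \<kappa>: "\<And>i. i \<in> {1..K} \<Longrightarrow> \<kappa> i \<in> \<C> \<and> i \<in> \<kappa> i" by metis
  define part where "part C = {i \<in> {1..K}. \<kappa> i = C}" for C
  \<comment> \<open>A class is empty if all arms of its clique are assigned elsewhere; its cost is
    then set to 0, as \<open>Max\<close> of the empty set is unspecified.\<close>
  define m where "m C = (if part C = {} then 0 else Max (?\<Delta> ` part C))" for C
  \<comment> \<open>Division by zero gives \<open>L C = 0\<close> for a clique of minimal gap 0; by
    \<open>zero\<close>, all gaps in such a clique of the covering vanish.\<close>
  define L where "L C = 8 * ln (real n) / (clique_gap ?\<Delta> C)\<^sup>2" for C
  have fin_part: "finite (part C)" for C by (simp add: part_def)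
  have part_sub: "part C \<subseteq> C" for C using \<kappa> by (auto simp: part_def)
  have m_attained: "\<exists>i\<in>part C. m C = ?\<Delta> i" if "part C \<noteq> {}" for C
  proof -
    have "Max (?\<Delta> ` part C) \<in> ?\<Delta> ` part C" using that fin_part by (intro Max_in) auto
    with that show ?thesis by (auto simp: m_def)
  qed
  have part_arms: "part C \<subseteq> {1..K}" for C by (auto simp: part_def)
  have m_nonneg: "m C \<ge> 0" for C
    using m_attained[of C] \<Delta>_nonneg part_arms[of C] by (cases "part C = {}") (auto simp: m_def)
  have m_ge: "0 \<le> ?\<Delta> i \<and> ?\<Delta> i \<le> m (\<kappa> i)" if "i \<in> {1..K}" for i
    using that \<Delta>_nonneg fin_part by (auto simp: m_def part_def intro!: Max_ge)
  have gapC: "0 \<le> clique_gap ?\<Delta> C" "\<And>i. i \<in> C \<Longrightarrow> clique_gap ?\<Delta> C \<le> ?\<Delta> i" if "C \<in> \<C>" for C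
    using clq[OF that] finC[OF that] \<Delta>_nonneg by (auto simp: clique_gap_def)
  have maxC: "?\<Delta> i \<le> Max (?\<Delta> ` C)" if "C \<in> \<C>" "i \<in> C" for C i
    using that finC by auto
  have "expectation (regret X I istar n) = expectation (\<lambda>\<omega>. \<Sum>t=1..n. ?\<Delta> (I t \<omega>))"
    by (rule expectation_regret[OF istar_in])
  also have "\<dots> \<le> (\<Sum>C\<in>\<C>. m C * (L C + 1)) + pi\<^sup>2 / 3 * (\<Sum>i=1..K. ?\<Delta> i)"
  proof (rule expected_sum_pulls_le[OF istar_in \<kappa> fin])
    fix i assume i: "i \<in> {1..K}" and pos: "?\<Delta> i > 0"
    have C: "\<kappa> i \<in> \<C>" "i \<in> \<kappa> i" using \<kappa>[OF i] by auto
    have "clique_gap ?\<Delta> (\<kappa> i) \<noteq> 0" using zero[OF C(1)] maxC[OF C] pos by auto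
    then have g: "clique_gap ?\<Delta> (\<kappa> i) > 0" using gapC(1)[OF C(1)] by simp
    have "8 * ln (real n) / (?\<Delta> i)\<^sup>2 \<le> L (\<kappa> i)"
      unfolding L_def using g gapC(2)[OF C] n by (intro divide_left_mono power_mono) auto
    \<comment> \<open>Here \<open>n \<ge> 2\<close> is used: for \<open>n = 1\<close> the logarithm,
      and with it the threshold, would be 0.\<close>
    moreover have "0 < L (\<kappa> i)" unfolding L_def using g n by simp
    ultimately show "0 < L (\<kappa> i) \<and> 8 * ln (real n) / (?\<Delta> i)\<^sup>2 \<le> L (\<kappa> i)" by simp
  qed (use clq m_ge m_nonneg n in \<open>auto simp: L_def\<close>)
  also have "(\<Sum>C\<in>\<C>. m C * (L C + 1)) = (\<Sum>C\<in>\<C>. m C * L C) + (\<Sum>C\<in>\<C>. m C)"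
    by (simp add: distrib_left sum.distrib)
  also have "(\<Sum>C\<in>\<C>. m C) \<le> (\<Sum>C\<in>\<C>. \<Sum>i\<in>part C. ?\<Delta> i)"
  proof (rule sum_mono)
    fix C
    show "m C \<le> (\<Sum>i\<in>part C. ?\<Delta> i)"
    proof (cases "part C = {}")
      case False
      then obtain i where "i \<in> part C" "m C = ?\<Delta> i" using m_attained by blast
      then show ?thesis using fin_part \<Delta>_nonneg part_arms[of C]
        by (auto intro!: member_le_sum)
    qed (simp add: m_def)
  qed
  \<comment> \<open>The classes \<open>part C\<close> partition the arms, even if the cliques
    overlap.\<close>
  also have "\<dots> = (\<Sum>i=1..K. ?\<Delta> i)"
    unfolding part_def using \<kappa> by (intro sum.group fin) auto
  \<comment> \<open>Only in the logarithmic term is the maximum enlarged from the class to the whole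
    clique.\<close>
  also have "(\<Sum>C\<in>\<C>. m C * L C) \<le> (\<Sum>C\<in>\<C>. Max (?\<Delta> ` C) * L C)"
  proof (intro sum_mono mult_right_mono)
    fix C assume C: "C \<in> \<C>"
    obtain i where i: "i \<in> C" using clq(2)[OF C] by blast
    then have "0 \<le> ?\<Delta> i" using clq(1)[OF C] \<Delta>_nonneg by blast
    then have "0 \<le> Max (?\<Delta> ` C)" using maxC[OF C i] by linarith
    then show "m C \<le> Max (?\<Delta> ` C)"
      using m_attained[of C] maxC[OF C] part_sub[of C] by (cases "part C = {}") (auto simp: m_def)
    show "0 \<le> L C" using n by (simp add: L_def)
  qed
  also have "(\<Sum>C\<in>\<C>. Max (?\<Delta> ` C) * L C)
      = 8 * (\<Sum>C\<in>\<C>. Max (?\<Delta> ` C) / (clique_gap ?\<Delta> C)\<^sup>2) * ln (real n)"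
    by (simp add: L_def sum_distrib_left sum_distrib_right mult_ac)
  finally show ?thesis by (simp add: algebra_simps)
qed

text \<open>For \<open>n = 1\<close> the logarithmic term vanishes, but a single pull costs one gap,
  at most the sum of all gaps.\<close>

lemma expected_regret_one_le:
  assumes istar: "is_arg_max (arm_mean P) (\<lambda>i. i \<in> {1..K}) istar"
  shows "expectation (regret X I istar 1) \<le> (1 + pi\<^sup>2 / 3) * (\<Sum>i=1..K. gap P istar i)"
proof -
  note \<Delta>_nonneg = gap_nonneg[OF istar]
  then have le: "gap P istar (I 1 \<omega>) \<le> (\<Sum>i=1..K. gap P istar i)" if "\<omega> \<in> space M" for \<omega>
    using I_in_arms[OF _ that] by (intro member_le_sum) auto
  have "istar \<in> {1..K}" using istar by (simp add: is_arg_max_def)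
  then have "expectation (regret X I istar 1) = expectation (\<lambda>\<omega>. gap P istar (I 1 \<omega>))"
    by (simp add: expectation_regret)
  also have "\<dots> \<le> expectation (\<lambda>_. \<Sum>i=1..K. gap P istar i)"
    by (rule integral_mono) (use le integrable_regret_terms(3) in auto)
  also have "\<dots> = 1 * (\<Sum>i=1..K. gap P istar i)" by (simp add: prob_space)
  also have "\<dots> \<le> (1 + pi\<^sup>2 / 3) * (\<Sum>i=1..K. gap P istar i)"
    using \<Delta>_nonneg by (intro mult_right_mono sum_nonneg) auto
  finally show ?thesis .
qed

text \<open>The real additive term is moved to the left so that the right-hand side is exactly the
  quantity under the infimum.\<close>

lemma expected_regret_le_covering_ereal:
  assumes istar: "is_arg_max (arm_mean P) (\<lambda>i. i \<in> {1..K}) istar"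
    and \<C>: "\<C> \<in> clique_coverings {1..K} E" and n: "n \<ge> 1"
  shows "ereal (expectation (regret X I istar n) - (1 + pi\<^sup>2 / 3) * (\<Sum>i=1..K. gap P istar i))
    \<le> 8 * (\<Sum>C\<in>\<C>. clique_ratio (gap P istar) C) * ereal (ln (real n))"
proof -
  let ?\<Delta> = "gap P istar"
  note \<Delta>_nonneg = gap_nonneg[OF istar]
  have clq: "C \<subseteq> {1..K}" "C \<noteq> {}" if "C \<in> \<C>" for C
    using \<C> that by (auto simp: clique_coverings_def)
  have fin: "finite \<C>"
    using clq by (intro finite_subset[of \<C> "Pow {1..K}"]) auto
  have max_nonneg: "Max (?\<Delta> ` C) \<ge> 0" if C: "C \<in> \<C>" for C
  proof -
    have "finite C" using clq(1)[OF C] by (rule finite_subset) simp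
    then have "Max (?\<Delta> ` C) \<in> ?\<Delta> ` C" using clq(2)[OF C] by (intro Max_in) auto
    then show ?thesis using clq(1)[OF C] \<Delta>_nonneg by auto
  qed
  \<comment> \<open>For \<open>n = 1\<close> the right-hand side is 0 even if a ratio is infinite,
    since \<open>\<infinity> * 0 = 0\<close> in \<open>ereal\<close>. For \<open>n \<ge> 2\<close>
    either all ratios are finite, or one infinite ratio and \<open>ln n > 0\<close> make the bound
    trivial.\<close>
  consider "n = 1" | "n \<ge> 2" "\<And>C. C \<in> \<C> \<Longrightarrow> clique_gap ?\<Delta> C = 0 \<Longrightarrow> Max (?\<Delta> ` C) = 0"
    | C where "n \<ge> 2" "C \<in> \<C>" "clique_gap ?\<Delta> C = 0" "Max (?\<Delta> ` C) \<noteq> 0"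
    using n by (metis le_neq_implies_less one_add_one Suc_eq_plus1 Suc_leI)
  then show ?thesis
  proof cases
    case 1
    with expected_regret_one_le[OF istar] show ?thesis by (simp add: zero_ereal_def[symmetric])
  next
    case 2
    have "clique_ratio ?\<Delta> C = ereal (Max (?\<Delta> ` C) / (clique_gap ?\<Delta> C)\<^sup>2)" if "C \<in> \<C>" for C
      using 2(2)[OF that] by (cases "clique_gap ?\<Delta> C = 0") (auto simp: clique_ratio_def)
    then have "(\<Sum>C\<in>\<C>. clique_ratio ?\<Delta> C) = ereal (\<Sum>C\<in>\<C>. Max (?\<Delta> ` C) / (clique_gap ?\<Delta> C)\<^sup>2)"
      by simp
    with expected_regret_le_covering[OF istar \<C> 2] show ?thesis
      by (simp add: algebra_simps)
  next
    case 3
    then have "clique_ratio ?\<Delta> C = \<infinity>"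
      using max_nonneg[of C] by (intro clique_ratio_gap_zero) auto
    then have "(\<Sum>C\<in>\<C>. clique_ratio ?\<Delta> C) = \<infinity>"
      using fin 3(2) by (auto simp: sum_Pinfty)
    then show ?thesis using 3(1) by simp
  qed
qed

end

theorem theorem2:
  fixes M :: "'a measure"
    and K :: nat
    and E :: "nat set set"
    and P :: "nat \<Rightarrow> real measure"
    and X :: "nat \<Rightarrow> nat \<Rightarrow> 'a \<Rightarrow> real"
    and S :: "'u measure"
    and U :: "'a \<Rightarrow> 'u"
    and I :: "nat \<Rightarrow> 'a \<Rightarrow> nat"
    and istar n :: nat
  assumes "ucb_n M K E P X S U I"
    and "is_arg_max (arm_mean P) (\<lambda>i. i \<in> {1..K}) istar"
    and "n \<ge> 1"
  shows "ereal (\<integral>\<omega>. regret X I istar n \<omega> \<partial>M)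
    \<le> (INF \<C>\<in>clique_coverings {1..K} E.
          8 * (\<Sum>C\<in>\<C>. clique_ratio (gap P istar) C) * ereal (ln (real n)))
      + ereal ((1 + pi\<^sup>2 / 3) * (\<Sum>i=1..K. gap P istar i))"
proof -
  interpret ucb_n M K E P X S U I by fact
  let ?b = "(1 + pi\<^sup>2 / 3) * (\<Sum>i=1..K. gap P istar i)"
  have "ereal (expectation (regret X I istar n) - ?b)
    \<le> (INF \<C>\<in>clique_coverings {1..K} E.
          8 * (\<Sum>C\<in>\<C>. clique_ratio (gap P istar) C) * ereal (ln (real n)))"
    by (intro INF_greatest expected_regret_le_covering_ereal assms)
  \<comment> \<open>Adding back a finite term is monotone and cancels the real subtraction.\<close>
  then have "ereal (expectation (regret X I istar n) - ?b) + ereal ?b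
    \<le> (INF \<C>\<in>clique_coverings {1..K} E.
          8 * (\<Sum>C\<in>\<C>. clique_ratio (gap P istar) C) * ereal (ln (real n))) + ereal ?b"
    by (rule add_right_mono)
  then show ?thesis by simp
qed

end
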